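(* Let $(G,F,\mathcal{C})$ be a framework and let $C_1,C_2\in\mathcal{C}$ be distinct with $|E(C_1\cap C_2)|\ge 2$. Then $|E(C_1)|\ge 4$.
   Context: All graphs are finite and simple; paths and circuits have no repeated vertices. The ends of a path are its first and last vertices, its end-edges its first and last edges. For a set of edges $E'$, $G\setminus E'$ is obtained from $G$ by deleting those edges (keeping all vertices). For a path or circuit $C$, a sequence of vertices/edges is "in order" in $C$ if they are met in that order traversing $C$ (from one end if $C$ is a path; from some starting point if $C$ is a circuit). A framework is a triple $(G,F,\mathcal{C})$ where $G$ is cubic, $F$ is a subgraph of $G$, and $\mathcal{C}$ is a set of subgraphs of $G\setminus E(F)$, satisfying (F1)–(F7) below. Distinct edges $e,f$ are twinned if there exist distinct $C_1,C_2\in\mathcal{C}$ with $e,f\in E(C_1\cap C_2)$. (F1) Each member of $\mathcal{C}$ is an induced subgraph of $G\setminus E(F)$, has at least three edges, and is a path or a circuit. (F2) Every edge of $G\setminus E(F)$ belongs to some member of $\mathcal{C}$, and for every two edges $e,f$ of $G$ with a common end not in $V(F)$ there exists $C\in\mathcal{C}$ with $e,f\in E(C)$. (F3) If $C_1,C_2\in\mathcal{C}$ are distinct and $v\in V(C_1\cap C_2)$, then either $V(C_1\cap C_2)=\{v\}$, or $v$ is incident with an edge of $C_1\cap C_2$, or $v\in V(F)$. (F4) If $C_1\in\mathcal{C}$ is a path, every member of $\mathcal{C}$ containing an end-edge of $C_1$ is a path; and if $C_2\in\mathcal{C}\setminus\{C_1\}$ is also a path, then every component of $C_1\cap C_2$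 contains an end of $C_1$, and every edge of $C_1\cap C_2$ is an end-edge of $C_1$. (F5) If $C\in\mathcal{C}$ is a circuit then $|V(C\cap F)|\le 1$ and every vertex of $C\cap F$ has degree 1 in $F$; if $C\in\mathcal{C}$ is a path then every vertex of $C\cap F$ is an end of $C$ and has degree 0 or 2 in $F$. (F6) If $e,f$ are twinned and $C\in\mathcal{C}$ with $e\in E(C)$, then $|V(C)|\le 6$ and either: $f\in E(C)$, $C$ is a circuit, $e,f$ have a common end in $V(F)$, and no path in $\mathcal{C}$ contains any vertex of $e$ or $f$; or $f\in E(C)$, $C$ is a path with end-edges $e,f$, and $C\cap F$ is null; or $f\notin E(C)$, $C$ is a path with $|E(C)|=3$, $e$ is an end-edge of $C$, and no end of $e$ is in $V(F)$. (F7) Let $C\in\mathcal{C}$ be a path of length five with twinned end-edges $e,f$. Then $|E(C')|\le 4$ for every path $C'\in\mathcal{C}\setminus\{C\}$ containing $e$. Moreover, let $C$ have vertices $v_0,v_1,\dots,v_5$ in order; then there exists $C'\in\mathcal{C}$ with end-edges $e$ and $f$ and with ends $v_0$ and $v_4$. *)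

theory Defs
  imports Main
begin

record 'a ugraph =
  verts :: "'a set"
  edges :: "'a set set"

definition simple_graph :: "'a ugraph \<Rightarrow> bool" where
  "simple_graph G \<longleftrightarrow> finite (verts G) \<and> (\<forall>e\<in>edges G. e \<subseteq> verts G \<and> card e = 2)"

definition degree :: "'a ugraph \<Rightarrow> 'a \<Rightarrow> nat" where
  "degree G v = card {e \<in> edges G. v \<in> e}"

definition cubic :: "'a ugraph \<Rightarrow> bool" where
  "cubic G \<longleftrightarrow> simple_graph G \<and> (\<forall>v\<in>verts G. degree G v = 3)"

definition subgraph :: "'a ugraph \<Rightarrow> 'a ugraph \<Rightarrow> bool" where
  "subgraph H G \<longleftrightarrow> simple_graph H \<and> verts H \<subseteq> verts G \<and> edges H \<subseteq> edges G"

definition induced_subgraph :: "'a ugraph \<Rightarrow> 'a ugraph \<Rightarrow> bool" where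
  "induced_subgraph H G \<longleftrightarrow> subgraph H G \<and> edges H = {e \<in> edges G. e \<subseteq> verts H}"

definition delete_edges :: "'a ugraph \<Rightarrow> 'a set set \<Rightarrow> 'a ugraph" where
  "delete_edges G E' = \<lparr>verts = verts G, edges = edges G - E'\<rparr>"

definition inter_graph :: "'a ugraph \<Rightarrow> 'a ugraph \<Rightarrow> 'a ugraph" where
  "inter_graph G H = \<lparr>verts = verts G \<inter> verts H, edges = edges G \<inter> edges H\<rparr>"

text \<open>
  Paths and circuits are graphs, not vertex sequences. The predicates \<open>path_seq\<close> and
  \<open>circuit_seq\<close> say that the list enumerates the vertices of the graph in order; for a path the
  list is determined by the graph up to reversal.
\<close>

definition path_seq :: "'a list \<Rightarrow> 'a ugraph \<Rightarrow> bool" where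
  "path_seq vs P \<longleftrightarrow> vs \<noteq> [] \<and> distinct vs \<and> verts P = set vs \<and>
     edges P = {{vs ! i, vs ! Suc i} | i. Suc i < length vs}"

definition is_path :: "'a ugraph \<Rightarrow> bool" where
  "is_path P \<longleftrightarrow> (\<exists>vs. path_seq vs P)"

definition path_ends :: "'a ugraph \<Rightarrow> 'a set" where
  "path_ends P = {v. \<exists>vs. path_seq vs P \<and> (v = hd vs \<or> v = last vs)}"

definition path_end_edges :: "'a ugraph \<Rightarrow> 'a set set" where
  "path_end_edges P = {e. \<exists>vs. path_seq vs P \<and> length vs \<ge> 2 \<and>
     (e = {vs ! 0, vs ! 1} \<or> e = {vs ! (length vs - 2), vs ! (length vs - 1)})}"

definition circuit_seq :: "'a list \<Rightarrow> 'a ugraph \<Rightarrow> bool" where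
  "circuit_seq vs C \<longleftrightarrow> length vs \<ge> 3 \<and> distinct vs \<and> verts C = set vs \<and>
     edges C = {{vs ! i, vs ! (Suc i mod length vs)} | i. i < length vs}"

definition is_circuit :: "'a ugraph \<Rightarrow> bool" where
  "is_circuit C \<longleftrightarrow> (\<exists>vs. circuit_seq vs C)"

definition connected_graph :: "'a ugraph \<Rightarrow> bool" where
  "connected_graph H \<longleftrightarrow> verts H \<noteq> {} \<and>
     (\<forall>u\<in>verts H. \<forall>v\<in>verts H. \<exists>P. subgraph P H \<and> is_path P \<and> path_ends P = {u, v})"

definition component :: "'a ugraph \<Rightarrow> 'a ugraph \<Rightarrow> bool" where
  "component K H \<longleftrightarrow> subgraph K H \<and> connected_graph K \<and>
     (\<forall>K'. subgraph K' H \<and> connected_graph K' \<and> subgraph K K' \<longrightarrow> K' = K)"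

definition twinned :: "'a ugraph set \<Rightarrow> 'a set \<Rightarrow> 'a set \<Rightarrow> bool" where
  "twinned \<C> e f \<longleftrightarrow> e \<noteq> f \<and>
     (\<exists>C\<^sub>1\<in>\<C>. \<exists>C\<^sub>2\<in>\<C>. C\<^sub>1 \<noteq> C\<^sub>2 \<and> e \<in> edges (inter_graph C\<^sub>1 C\<^sub>2) \<and> f \<in> edges (inter_graph C\<^sub>1 C\<^sub>2))"

text \<open>
  In \<open>F7\<close>, the vertices of \<open>C\<close> may be listed from either end, so the final clause also yields
  a path with ends \<open>v\<^sub>5\<close> and \<open>v\<^sub>1\<close>; likewise the roles of \<open>e\<close> and \<open>f\<close> may be exchanged.
\<close>

locale framework =
  fixes G F :: "'a ugraph" and \<C> :: "'a ugraph set"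
  assumes cubic: "cubic G"
    and subgraph_F: "subgraph F G"
    and subgraph_members: "C \<in> \<C> \<Longrightarrow> subgraph C (delete_edges G (edges F))"
    and F1: "C \<in> \<C> \<Longrightarrow>
      induced_subgraph C (delete_edges G (edges F)) \<and> card (edges C) \<ge> 3 \<and>
      (is_path C \<or> is_circuit C)"
    and F2_cover: "e \<in> edges (delete_edges G (edges F)) \<Longrightarrow> \<exists>C\<in>\<C>. e \<in> edges C"
    and F2_pairs: "\<lbrakk>e \<in> edges G; f \<in> edges G; e \<noteq> f; v \<in> e; v \<in> f; v \<notin> verts F\<rbrakk> \<Longrightarrow>
      \<exists>C\<in>\<C>. e \<in> edges C \<and> f \<in> edges C"
    and F3: "\<lbrakk>C\<^sub>1 \<in> \<C>; C\<^sub>2 \<in> \<C>; C\<^sub>1 \<noteq> C\<^sub>2; v \<in> verts (inter_graph C\<^sub>1 C\<^sub>2)\<rbrakk> \<Longrightarrow>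
      verts (inter_graph C\<^sub>1 C\<^sub>2) = {v} \<or>
      (\<exists>e\<in>edges (inter_graph C\<^sub>1 C\<^sub>2). v \<in> e) \<or>
      v \<in> verts F"
    and F4_end_edge: "\<lbrakk>C\<^sub>1 \<in> \<C>; is_path C\<^sub>1; e \<in> path_end_edges C\<^sub>1; C \<in> \<C>; e \<in> edges C\<rbrakk> \<Longrightarrow>
      is_path C"
    and F4_inter: "\<lbrakk>C\<^sub>1 \<in> \<C>; is_path C\<^sub>1; C\<^sub>2 \<in> \<C> - {C\<^sub>1}; is_path C\<^sub>2\<rbrakk> \<Longrightarrow>
      (\<forall>K. component K (inter_graph C\<^sub>1 C\<^sub>2) \<longrightarrow> (\<exists>v\<in>path_ends C\<^sub>1. v \<in> verts K)) \<and>
      edges (inter_graph C\<^sub>1 C\<^sub>2) \<subseteq> path_end_edges C\<^sub>1"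
    and F5_circuit: "\<lbrakk>C \<in> \<C>; is_circuit C\<rbrakk> \<Longrightarrow>
      card (verts (inter_graph C F)) \<le> 1 \<and> (\<forall>v\<in>verts (inter_graph C F). degree F v = 1)"
    and F5_path: "\<lbrakk>C \<in> \<C>; is_path C; v \<in> verts (inter_graph C F)\<rbrakk> \<Longrightarrow>
      v \<in> path_ends C \<and> (degree F v = 0 \<or> degree F v = 2)"
    and F6: "\<lbrakk>twinned \<C> e f; C \<in> \<C>; e \<in> edges C\<rbrakk> \<Longrightarrow>
      card (verts C) \<le> 6 \<and>
      ((f \<in> edges C \<and> is_circuit C \<and> (\<exists>v\<in>verts F. v \<in> e \<and> v \<in> f) \<and>
          (\<forall>P\<in>\<C>. is_path P \<longrightarrow> verts P \<inter> (e \<union> f) = {})) \<or>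
       (f \<in> edges C \<and> is_path C \<and> path_end_edges C = {e, f} \<and> verts (inter_graph C F) = {}) \<or>
       (f \<notin> edges C \<and> is_path C \<and> card (edges C) = 3 \<and> e \<in> path_end_edges C \<and>
          e \<inter> verts F = {}))"
    and F7_length: "\<lbrakk>C \<in> \<C>; is_path C; card (edges C) = 5; path_end_edges C = {e, f};
        twinned \<C> e f; C' \<in> \<C> - {C}; is_path C'; e \<in> edges C'\<rbrakk> \<Longrightarrow>
      card (edges C') \<le> 4"
    and F7_exists: "\<lbrakk>C \<in> \<C>; is_path C; card (edges C) = 5; path_end_edges C = {e, f};
        twinned \<C> e f; path_seq [v\<^sub>0, v\<^sub>1, v\<^sub>2, v\<^sub>3, v\<^sub>4, v\<^sub>5] C\<rbrakk> \<Longrightarrow>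
      \<exists>C'\<in>\<C>. is_path C' \<and> path_end_edges C' = {e, f} \<and> path_ends C' = {v\<^sub>0, v\<^sub>4}"

end

(* Two edges shared by C1 and C2 are twinned.  If C1 has only three edges then these two cover
   V(C1): either C1 is a triangle, or C1 is a path and they are its end-edges.  As C2 is induced,
   C1 is a subgraph of C2.  A circuit containing a triangle equals it, and for paths (F4) makes
   every edge of C1 an end-edge; both are impossible. *)
theory Submission
  imports Defs
begin

text \<open>Distinctness of the vertices makes the map sending \<open>i\<close> to the
  \<open>i\<close>-th edge injective, and its index set has \<open>length vs - 1\<close>
  elements.\<close>

lemma path_seq_card_edges:
  assumes "path_seq vs P"
  shows "Suc (card (edges P)) = length vs"
proof -
  have d: "distinct vs" and ne: "vs \<noteq> []"
    and E: "edges P = (\<lambda>i. {vs ! i, vs ! Suc i}) ` {i. Suc i < length vs}"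
    using assms by (auto simp: path_seq_def)
  have "inj_on (\<lambda>i. {vs ! i, vs ! Suc i}) {i. Suc i < length vs}"
    using d by (auto simp: inj_on_def doubleton_eq_iff nth_eq_iff_index_eq)
  moreover have "{i. Suc i < length vs} = {..<length vs - 1}"
    by auto
  ultimately show ?thesis
    using E ne by (simp add: card_image)
qed

lemma Suc_mod_if: "i < n \<Longrightarrow> Suc i mod n = (if Suc i = n then 0 else Suc i)"
  by auto

lemma circuit_seq_card_edges:
  assumes "circuit_seq vs C"
  shows "card (edges C) = length vs"
proof -
  have d: "distinct vs" and n: "length vs \<ge> 3"
    and E: "edges C = (\<lambda>i. {vs ! i, vs ! (Suc i mod length vs)}) ` {..<length vs}"
    using assms by (auto simp: circuit_seq_def)
  have "i = j" if ij: "i < length vs" "j < length vs"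
    and eq: "{vs ! i, vs ! (Suc i mod length vs)} = {vs ! j, vs ! (Suc j mod length vs)}" for i j
  proof -
    have "Suc i mod length vs < length vs" "Suc j mod length vs < length vs"
      using ij by (auto intro!: mod_less_divisor)
    then have "i = j \<or> i = Suc j mod length vs \<and> Suc i mod length vs = j"
      using eq d ij by (auto simp: doubleton_eq_iff nth_eq_iff_index_eq)
    \<comment> \<open>The second alternative would bring two cyclic steps from \<open>i\<close> back
      to \<open>i\<close>, so the length would divide 2; it is at least 3.\<close>
    then show ?thesis
      using ij n by (auto simp: Suc_mod_if split: if_splits)
  qed
  then have "inj_on (\<lambda>i. {vs ! i, vs ! (Suc i mod length vs)}) {..<length vs}"
    by (auto simp: inj_on_def)
  then show ?thesis
    using E by (simp add: card_image)
qed

text \<open>The cyclic successor is spelled out by a case distinction instead of \<open>mod\<close>,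
  so that later uses reduce to linear arithmetic on positions.\<close>

lemma circuit_seq_adjacent:
  assumes "circuit_seq vs C" "i < length vs" "j < length vs" "{vs ! i, vs ! j} \<in> edges C"
  shows "j = (if Suc i = length vs then 0 else Suc i) \<or>
    i = (if Suc j = length vs then 0 else Suc j)"
proof -
  obtain k where k: "k < length vs" "{vs ! i, vs ! j} = {vs ! k, vs ! (Suc k mod length vs)}"
    using assms by (auto simp: circuit_seq_def)
  have "Suc k mod length vs < length vs"
    using k by (auto intro!: mod_less_divisor)
  then have "i = k \<and> j = Suc k mod length vs \<or> i = Suc k mod length vs \<and> j = k"
    using k assms by (auto simp: circuit_seq_def doubleton_eq_iff nth_eq_iff_index_eq)
  then show ?thesis
    using k(1) by (auto simp: Suc_mod_if split: if_splits)
qed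

text \<open>The corners of the triangle occupy three pairwise cyclically adjacent positions in the
  larger circuit, which is possible only if that circuit has exactly three vertices.\<close>

lemma triangle_subset_circuit_verts:
  assumes T: "is_circuit T" "card (edges T) = 3"
    and C: "is_circuit C" and sub: "verts T \<subseteq> verts C" "edges T \<subseteq> edges C"
  shows "verts T = verts C"
proof -
  obtain vs where vs: "circuit_seq vs T"
    using T by (auto simp: is_circuit_def)
  obtain ws where ws: "circuit_seq ws C"
    using C by (auto simp: is_circuit_def)
  have len: "length vs = 3"
    using circuit_seq_card_edges[OF vs] T by simp
  have vT: "verts T = set vs" "distinct vs" and wC: "verts C = set ws" "length ws \<ge> 3"
    using vs ws by (auto simp: circuit_seq_def)
  have edge: "{vs ! i, vs ! (Suc i mod 3)} \<in> edges T" if "i < 3" for i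
    using vs len that by (auto simp: circuit_seq_def)
  have E: "{vs ! 0, vs ! 1} \<in> edges C" "{vs ! 1, vs ! 2} \<in> edges C" "{vs ! 2, vs ! 0} \<in> edges C"
    using edge[of 0] edge[of 1] edge[of 2] sub by (auto simp: numeral_2_eq_2)
  have mem: "vs ! i \<in> set ws" if "i < 3" for i
    using that len vT sub wC by auto
  obtain i j k where ijk: "i < length ws" "j < length ws" "k < length ws"
    "ws ! i = vs ! 0" "ws ! j = vs ! 1" "ws ! k = vs ! 2"
    using mem[of 0] mem[of 1] mem[of 2] by (auto simp: in_set_conv_nth)
  have dist: "vs ! 0 \<noteq> vs ! 1" "vs ! 1 \<noteq> vs ! 2" "vs ! 2 \<noteq> vs ! 0"
    using vT(2) len by (auto simp: nth_eq_iff_index_eq)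
  have "i \<noteq> j" "j \<noteq> k" "k \<noteq> i"
    using dist ijk by metis+
  moreover have
    "j = (if Suc i = length ws then 0 else Suc i) \<or> i = (if Suc j = length ws then 0 else Suc j)"
    "k = (if Suc j = length ws then 0 else Suc j) \<or> j = (if Suc k = length ws then 0 else Suc k)"
    "i = (if Suc k = length ws then 0 else Suc k) \<or> k = (if Suc i = length ws then 0 else Suc i)"
    using circuit_seq_adjacent[OF ws] ijk E by auto
  \<comment> \<open>Going round \<open>i\<close>, \<open>j\<close>, \<open>k\<close> adds up three
    steps of +1 or -1 to a multiple of \<open>length ws\<close>. The sum is odd and at most 3 in
    absolute value, so a length of at least 3 must equal 3.\<close>
  ultimately have "length ws = 3"
    using ijk(1-3) wC(2) by (auto split: if_splits)
  moreover have "distinct ws"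
    using ws by (simp add: circuit_seq_def)
  ultimately have "card (verts T) = card (verts C)"
    using vT wC(1) len by (simp add: distinct_card)
  then show ?thesis
    using card_subset_eq[of "verts C" "verts T"] sub(1) wC(1) by simp
qed

context framework
begin

text \<open>Members are induced in \<open>G\<close> without the edges of \<open>F\<close>, so the
  vertex set determines the edge set. Hence inclusions and equalities between members can be checked
  on vertices alone.\<close>

lemma edges_eq: "C \<in> \<C> \<Longrightarrow> edges C = {e \<in> edges G - edges F. e \<subseteq> verts C}"
  using F1 by (auto simp: induced_subgraph_def delete_edges_def)

lemma edge_subset_verts: "C \<in> \<C> \<Longrightarrow> e \<in> edges C \<Longrightarrow> e \<subseteq> verts C"
  using edges_eq by auto

lemma edges_mono: "C \<in> \<C> \<Longrightarrow> C' \<in> \<C> \<Longrightarrow> verts C \<subseteq> verts C' \<Longrightarrow> edges C \<subseteq> edges C'"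
  using edges_eq[of C] edges_eq[of C'] by auto

lemma members_eqI: "C \<in> \<C> \<Longrightarrow> C' \<in> \<C> \<Longrightarrow> verts C = verts C' \<Longrightarrow> C = C'"
  using edges_eq[of C] edges_eq[of C'] by (auto intro: ugraph.equality)

end

text \<open>The circuit is a triangle, and any two of its sides meet all three corners.\<close>

lemma circuit_three_edges_two_cover:
  assumes "is_circuit C" "card (edges C) = 3" "e \<in> edges C" "f \<in> edges C" "e \<noteq> f"
  shows "verts C = e \<union> f"
proof -
  obtain vs where vs: "circuit_seq vs C"
    using assms by (auto simp: is_circuit_def)
  then have "length vs = 3"
    using circuit_seq_card_edges assms by metis
  then obtain a b c where abc: "vs = [a, b, c]"
    by (auto simp: numeral_3_eq_3 length_Suc_conv)
  have "edges C = (\<lambda>i. {vs ! i, vs ! (Suc i mod length vs)}) ` {..<3}"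
    using vs abc by (auto simp: circuit_seq_def)
  also have "{..<3} = {0, 1, 2 :: nat}"
    by auto
  finally have "edges C = {{a, b}, {b, c}, {c, a}}"
    using abc by simp
  moreover have "verts C = {a, b, c}"
    using vs abc by (simp add: circuit_seq_def)
  ultimately show ?thesis
    using assms by auto
qed

lemma path_three_edges_end_edges_cover:
  assumes "is_path P" "card (edges P) = 3" "path_end_edges P = {e, f}"
  shows "verts P \<subseteq> e \<union> f"
proof -
  obtain vs where vs: "path_seq vs P"
    using assms by (auto simp: is_path_def)
  then have "length vs = 4"
    using path_seq_card_edges assms by fastforce
  then obtain a b c d where abcd: "vs = [a, b, c, d]"
    by (auto simp: numeral_eq_Suc length_Suc_conv)
  have "{a, b} \<in> path_end_edges P" "{c, d} \<in> path_end_edges P"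
    unfolding path_end_edges_def using vs abcd by (auto intro!: exI[of _ vs])
  moreover have "verts P = {a, b, c, d}" "distinct [a, b, c, d]"
    using vs abcd by (auto simp: path_seq_def)
  \<comment> \<open>Since \<open>{a, b}\<close> and \<open>{c, d}\<close> are distinct, they are
    \<open>e\<close> and \<open>f\<close> in some order.\<close>
  ultimately show ?thesis
    using assms(3) by (auto simp: doubleton_eq_iff)
qed

theorem theorem3p3:
  fixes G F :: "'a ugraph" and \<C> :: "'a ugraph set" and C\<^sub>1 C\<^sub>2 :: "'a ugraph"
  assumes "framework G F \<C>"
    and "C\<^sub>1 \<in> \<C>" and "C\<^sub>2 \<in> \<C>" and "C\<^sub>1 \<noteq> C\<^sub>2"
    and "card (edges (inter_graph C\<^sub>1 C\<^sub>2)) \<ge> 2"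
  shows "card (edges C\<^sub>1) \<ge> 4"
proof (rule ccontr)
  interpret framework G F \<C>
    by fact
  assume "\<not> ?thesis"
  then have three: "card (edges C\<^sub>1) = 3"
    using F1[OF assms(2)] by auto
  \<comment> \<open>An infinite set has \<open>card\<close> 0, so the bound 2 gives finiteness; a
    finite set whose elements all coincide has at most \<open>Suc 0\<close> elements.\<close>
  obtain e f where ef: "e \<in> edges (inter_graph C\<^sub>1 C\<^sub>2)" "f \<in> edges (inter_graph C\<^sub>1 C\<^sub>2)" "e \<noteq> f"
    using assms(5) card_le_Suc0_iff_eq[of "edges (inter_graph C\<^sub>1 C\<^sub>2)"]
    by (metis card.infinite not_less_eq_eq numeral_2_eq_2 zero_le)
  then have e: "e \<in> edges C\<^sub>1" "e \<in> edges C\<^sub>2" and f: "f \<in> edges C\<^sub>1" "f \<in> edges C\<^sub>2"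
    by (auto simp: inter_graph_def)
  have tw: "twinned \<C> e f"
    unfolding twinned_def using ef assms by blast
  have cover: "verts C\<^sub>1 \<subseteq> verts C\<^sub>2" "edges C\<^sub>1 \<subseteq> edges C\<^sub>2" if "verts C\<^sub>1 \<subseteq> e \<union> f"
  proof -
    show "verts C\<^sub>1 \<subseteq> verts C\<^sub>2"
      using that edge_subset_verts[OF assms(3)] e f by blast
    then show "edges C\<^sub>1 \<subseteq> edges C\<^sub>2"
      by (rule edges_mono[OF assms(2,3)])
  qed
  \<comment> \<open>The third alternative of \<open>F6\<close> requires \<open>f\<close> to lie
    outside \<open>C\<^sub>1\<close>, so two cases remain.\<close>
  consider (circuit) "is_circuit C\<^sub>1" "\<exists>v\<in>verts F. v \<in> e \<and> v \<in> f"
      "\<forall>P\<in>\<C>. is_path P \<longrightarrow> verts P \<inter> (e \<union> f) = {}"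
    | (path) "is_path C\<^sub>1" "path_end_edges C\<^sub>1 = {e, f}"
    using F6[OF tw assms(2) e(1)] f(1) by blast
  then show False
  proof cases
    case circuit
    \<comment> \<open>The common end of \<open>e\<close> and \<open>f\<close> is a vertex of
      \<open>C\<^sub>2\<close>, whereas paths in \<open>\<C>\<close> avoid both edges; so
      \<open>C\<^sub>2\<close> is a circuit.\<close>
    have "verts C\<^sub>2 \<inter> (e \<union> f) \<noteq> {}"
      using circuit(2) edge_subset_verts[OF assms(3) e(2)] by blast
    then have C2: "is_circuit C\<^sub>2"
      using circuit(3) F1[OF assms(3)] assms(3) by blast
    have "verts C\<^sub>1 = e \<union> f"
      using circuit_three_edges_two_cover[OF circuit(1) three e(1) f(1) ef(3)] .
    then have "verts C\<^sub>1 = verts C\<^sub>2"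
      using triangle_subset_circuit_verts[OF circuit(1) three C2] cover by blast
    then show False
      using members_eqI assms by blast
  next
    case path
    have sub: "edges C\<^sub>1 \<subseteq> edges C\<^sub>2"
      using path_three_edges_end_edges_cover[OF path(1) three path(2)] by (rule cover)
    \<comment> \<open>\<open>C\<^sub>2\<close> contains the end-edge \<open>e\<close> of the path
      \<open>C\<^sub>1\<close>. Once it is a path, \<open>F4_inter\<close> excludes the middle edge
      of \<open>C\<^sub>1\<close> from the intersection, although \<open>sub\<close> puts it
      there.\<close>
    have "is_path C\<^sub>2"
      using F4_end_edge[OF assms(2) path(1) _ assms(3) e(2)] path(2) by blast
    then have "edges (inter_graph C\<^sub>1 C\<^sub>2) \<subseteq> {e, f}"
      using F4_inter[OF assms(2) path(1), of C\<^sub>2] assms path(2) by auto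
    then have "edges C\<^sub>1 \<subseteq> {e, f}"
      using sub by (auto simp: inter_graph_def)
    then have "card (edges C\<^sub>1) \<le> 2"
      using card_mono[of "{e, f}" "edges C\<^sub>1"] by (simp add: card_insert_if split: if_splits)
    then show False
      using three by simp
  qed
qed

end
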